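(* Let $I:=(-1,1)$, $B>0$, $T\ge 0$, $\alpha>0$. If $u$ is a classical solution to the quasi-linear equation $$B\left(\frac{u''}{(1+(u')^2)^\alpha}\right)''+\alpha B\left(\frac{u'(u'')^2}{(1+(u')^2)^{\alpha+1}}\right)'-T\left(\frac{u'}{\sqrt{1+(u')^2}}\right)'=f \quad\text{in } I,$$ subject to the homogeneous Dirichlet boundary conditions $u(\pm1)=u'(\pm1)=0$, with right-hand side $f\le 0$ in $I$ and $f\not\equiv 0$, then $u<0$ in $I$.
   Context: A classical solution is a function $u\in C^4(I)\cap C^2([-1,1])$ satisfying the equation pointwise in $I$ and the boundary conditions. *)

theory Defs
  imports "HOL-Analysis.Analysis"
begin

text \<open>
  Derivatives are taken relative to \<^term>\<open>S\<close>: at an endpoint of a closed interval they are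
  one-sided, so values outside \<^term>\<open>S\<close> play no role, and at an interior point of \<^term>\<open>S\<close>
  they agree with \<^const>\<open>deriv\<close>.
\<close>

definition deriv_within :: "real set \<Rightarrow> (real \<Rightarrow> real) \<Rightarrow> real \<Rightarrow> real" where
  "deriv_within S g = (\<lambda>x. vector_derivative g (at x within S))"

definition C_class :: "nat \<Rightarrow> real set \<Rightarrow> (real \<Rightarrow> real) \<Rightarrow> bool" where
  "C_class k S g \<longleftrightarrow>
     (\<forall>j<k. (deriv_within S ^^ j) g differentiable_on S) \<and>
     (\<forall>j\<le>k. continuous_on S ((deriv_within S ^^ j) g))"

definition quasilinear_operator ::
    "real \<Rightarrow> real \<Rightarrow> real \<Rightarrow> (real \<Rightarrow> real) \<Rightarrow> real \<Rightarrow> real" where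
  "quasilinear_operator B T \<alpha> u x =
     B * deriv (deriv (\<lambda>y. deriv (deriv u) y / (1 + (deriv u y)\<^sup>2) powr \<alpha>)) x
     + \<alpha> * B * deriv (\<lambda>y. deriv u y * (deriv (deriv u) y)\<^sup>2 / (1 + (deriv u y)\<^sup>2) powr (\<alpha> + 1)) x
     - T * deriv (\<lambda>y. deriv u y / sqrt (1 + (deriv u y)\<^sup>2)) x"

definition classical_solution ::
    "real \<Rightarrow> real \<Rightarrow> real \<Rightarrow> (real \<Rightarrow> real) \<Rightarrow> (real \<Rightarrow> real) \<Rightarrow> bool" where
  "classical_solution B T \<alpha> f u \<longleftrightarrow>
     C_class 4 {-1<..<1} u \<and> C_class 2 {-1..1} u \<and>
     (\<forall>x\<in>{-1<..<1}. quasilinear_operator B T \<alpha> u x = f x) \<and>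
     u (-1) = 0 \<and> u 1 = 0 \<and>
     deriv_within {-1..1} u (-1) = 0 \<and> deriv_within {-1..1} u 1 = 0"

end

theory Submission
  imports Defs
begin

text \<open>
  Put \<open>v = u'\<close>. The left-hand side of the equation is the derivative of the third-order
  \<^emph>\<open>flux\<close>
  \<open>F = B v'' / (1+v\<^sup>2)\<^sup>\<alpha> - \<alpha> B v v'\<^sup>2 / (1+v\<^sup>2)\<^sup>\<alpha>\<^sup>+\<^sup>1 - T v / sqrt (1+v\<^sup>2)\<close>,
  so \<open>F' = f \<le> 0\<close> and \<open>F\<close> is nonincreasing. With the weight
  \<open>p = (1+v\<^sup>2) powr (-\<alpha>/2)\<close> the flux becomes \<open>F = B p (p v')' - T v / sqrt (1+v\<^sup>2)\<close>:
  as an equation for \<open>v\<close>, it has order two and satisfies a maximum principle. If \<open>F \<ge> 0\<close> on an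
  interval at whose ends \<open>v\<close> vanishes, then \<open>v \<le> 0\<close> there, because \<open>p v'\<close> is nondecreasing
  wherever \<open>v > 0\<close>; so \<open>u\<close> is nonincreasing, and if moreover \<open>u\<close> is no smaller at the right end
  than at the left end, then \<open>u\<close> is constant (\<open>constant_if_flux_nonneg\<close>). As \<open>F\<close> is odd in \<open>u\<close>,
  the same holds with all signs reversed (\<open>constant_if_flux_nonpos\<close>).

  Suppose now that \<open>u\<close> is not negative throughout. Then \<open>u\<close> has a maximum point \<open>m\<close> inside the
  interval with \<open>u m \<ge> 0\<close>, and \<open>v\<close> vanishes at \<open>-1\<close>, \<open>m\<close> and \<open>1\<close>. If \<open>F m \<ge> 0\<close>, then
  \<open>F \<ge> 0\<close> to the left of \<open>m\<close>, so \<open>u = 0\<close> and hence \<open>F = 0\<close> there; by monotonicity \<open>F \<le> 0\<close>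
  to the right of \<open>m\<close>, so \<open>u = 0\<close> there too. The case \<open>F m \<le> 0\<close> is the mirror image. Either way
  \<open>u\<close> vanishes identically, hence so do \<open>F\<close> and \<open>f\<close>, contrary to \<open>f \<noteq> 0\<close>.
\<close>

section \<open>The flux and its maximum principle\<close>

definition flux :: "real \<Rightarrow> real \<Rightarrow> real \<Rightarrow> real \<Rightarrow> real \<Rightarrow> real \<Rightarrow> real" where
  "flux B T \<alpha> v v1 v2 =
     B * v2 / (1 + v\<^sup>2) powr \<alpha> - \<alpha> * B * (v * v1\<^sup>2 / (1 + v\<^sup>2) powr (\<alpha> + 1)) - T * (v / sqrt (1 + v\<^sup>2))"

lemma flux_minus: "flux B T \<alpha> (- v) (- v1) (- v2) = - flux B T \<alpha> v v1 v2"
  by (simp add: flux_def)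

lemma flux_zero [simp]: "flux B T \<alpha> 0 0 0 = 0"
  by (simp add: flux_def)

text \<open>
  From a positive maximum, where \<open>p v'\<close> vanishes, \<open>p v'\<close> cannot become negative while \<open>v\<close> stays
  positive. So \<open>v\<close> cannot fall from there to a nonpositive value at the right end.
\<close>

lemma nonpos_if_weighted_derivative_nondecreasing:
  fixes v v1 p q' :: "real \<Rightarrow> real"
  assumes cont: "continuous_on {a..b} v"
    and dv: "\<And>x. x \<in> {a<..<b} \<Longrightarrow> (v has_real_derivative v1 x) (at x)"
    and dq: "\<And>x. x \<in> {a<..<b} \<Longrightarrow> ((\<lambda>x. p x * v1 x) has_real_derivative q' x) (at x)"
    and p: "\<And>x. x \<in> {a<..<b} \<Longrightarrow> p x > 0"
    and q': "\<And>x. x \<in> {a<..<b} \<Longrightarrow> v x > 0 \<Longrightarrow> q' x \<ge> 0"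
    and ends: "v a \<le> 0" "v b \<le> 0"
    and x: "x \<in> {a..b}"
  shows "v x \<le> 0"
proof (rule ccontr)
  assume "\<not> v x \<le> 0"
  obtain m where m: "m \<in> {a..b}" and max: "\<And>y. y \<in> {a..b} \<Longrightarrow> v y \<le> v m"
    using continuous_attains_sup[OF compact_Icc _ cont] x by blast
  have vm: "v m > 0"
    using max[OF x] \<open>\<not> v x \<le> 0\<close> by simp
  with m ends have mab: "a < m" "m < b"
    by (metis atLeastAtMost_iff linorder_not_less order_le_less)+
  have v1m: "v1 m = 0"
  proof (rule DERIV_local_max[OF dv])
    show "m \<in> {a<..<b}" using mab by simp
    show "0 < min (m - a) (b - m)" using mab by simp
    show "\<forall>y. \<bar>m - y\<bar> < min (m - a) (b - m) \<longrightarrow> v y \<le> v m"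
      by (intro allI impI max) auto
  qed
  \<comment> \<open>the first point to the right of the maximum at which \<open>v\<close> is no longer positive\<close>
  define S where "S = {y \<in> {m..b}. v y \<in> {..0}}"
  have "continuous_on {m..b} v"
    using cont mab by (rule_tac continuous_on_subset) auto
  then have "closed S"
    unfolding S_def by (intro continuous_closed_preimage[unfolded vimage_def Int_def, simplified]) auto
  moreover have "bounded S"
    by (rule bounded_subset[of "{m..b}"]) (auto simp: S_def)
  moreover have "S \<noteq> {}"
    using mab ends by (auto simp: S_def)
  ultimately obtain y where y: "y \<in> S" and first: "\<And>z. z \<in> S \<Longrightarrow> y \<le> z"
    by (metis compact_attains_inf compact_eq_bounded_closed)
  have my: "m \<le> y" "y \<le> b" "v y \<le> 0"
    using y by (auto simp: S_def)
  have pos: "v z > 0" if "m \<le> z" "z < y" for z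
    using first[of z] that my by (force simp: S_def)
  have nonneg: "v1 z \<ge> 0" if z: "m < z" "z < y" for z
  proof -
    have "p m * v1 m \<le> p z * v1 z"
    proof (rule DERIV_nonneg_imp_nondecreasing[where f = "\<lambda>x. p x * v1 x"])
      show "m \<le> z" using z by simp
      show "\<exists>d. ((\<lambda>x. p x * v1 x) has_real_derivative d) (at w) \<and> 0 \<le> d"
        if "m \<le> w" "w \<le> z" for w
        using dq[of w] q'[of w] pos[of w] that z mab my by auto
    qed
    moreover have "p z > 0"
      using p[of z] z mab my by auto
    ultimately show ?thesis
      using v1m by (simp add: zero_le_mult_iff)
  qed
  have "v m \<le> v y"
  proof (rule DERIV_nonneg_imp_increasing_open[where f = v])
    show "m \<le> y" by (rule my)
    show "\<exists>d. (v has_real_derivative d) (at w) \<and> 0 \<le> d" if "m < w" "w < y" for w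
      using dv[of w] nonneg[of w] that mab my by auto
    show "continuous_on {m..y} v"
      using cont mab my by (rule_tac continuous_on_subset) auto
  qed
  then show False
    using vm my by simp
qed

text \<open>
  The exponent \<open>-\<alpha>/2\<close> is the one for which the derivative of the weight contributes exactly the
  term of the flux that is quadratic in \<open>v'\<close>, so that no sign condition on that term is needed.
\<close>

lemma weighted_derivative_has_derivative:
  fixes v v1 :: "real \<Rightarrow> real"
  assumes B: "B > 0"
    and dv: "(v has_real_derivative v1 x) (at x)"
    and dv1: "(v1 has_real_derivative v2) (at x)"
  shows "((\<lambda>x. (1 + (v x)\<^sup>2) powr (- \<alpha> / 2) * v1 x) has_real_derivative
      (1 + (v x)\<^sup>2) powr (\<alpha> / 2) / B * (flux B T \<alpha> (v x) (v1 x) v2 + T * (v x / sqrt (1 + (v x)\<^sup>2)))) (at x)"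
proof -
  define s where "s = 1 + (v x)\<^sup>2"
  have s: "s > 0" unfolding s_def by (simp add: add_pos_nonneg)
  have r: "s powr \<alpha> = s powr (\<alpha>/2) * s powr (\<alpha>/2)" "s powr (\<alpha> + 1) = s powr (\<alpha>/2) * s powr (\<alpha>/2) * s"
    using s by (simp_all flip: powr_add) (simp add: powr_add)
  have n: "s powr (- \<alpha> / 2) = 1 / s powr (\<alpha>/2)" "s powr (- \<alpha> / 2 - 1) = 1 / (s powr (\<alpha>/2) * s)"
    using s by (simp_all add: powr_diff powr_minus_divide)
  have "((\<lambda>x. (1 + (v x)\<^sup>2) powr (- \<alpha> / 2) * v1 x) has_real_derivative
      (- \<alpha> / 2) * s powr (- \<alpha> / 2 - 1) * (2 * v x * v1 x) * v1 x + s powr (- \<alpha> / 2) * v2) (at x)"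
    unfolding s_def
    by (rule derivative_eq_intros dv dv1 refl | use s in \<open>simp add: s_def powr_diff\<close>)+
  moreover have "(- \<alpha> / 2) * s powr (- \<alpha> / 2 - 1) * (2 * v x * v1 x) * v1 x + s powr (- \<alpha> / 2) * v2
      = s powr (\<alpha> / 2) / B * (flux B T \<alpha> (v x) (v1 x) v2 + T * (v x / sqrt s))"
    using s B unfolding flux_def s_def[symmetric] n r
    by (simp add: field_simps power2_eq_square)
  ultimately show ?thesis
    unfolding s_def by simp
qed

lemma constant_if_flux_nonneg:
  fixes u v v1 v2 :: "real \<Rightarrow> real"
  assumes B: "B > 0" and T: "T \<ge> 0"
    and cu: "continuous_on {a..b} u" and cv: "continuous_on {a..b} v"
    and du: "\<And>x. x \<in> {a<..<b} \<Longrightarrow> (u has_real_derivative v x) (at x)"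
    and dv: "\<And>x. x \<in> {a<..<b} \<Longrightarrow> (v has_real_derivative v1 x) (at x)"
    and dv1: "\<And>x. x \<in> {a<..<b} \<Longrightarrow> (v1 has_real_derivative v2 x) (at x)"
    and ends: "v a = 0" "v b = 0" "u a \<le> u b"
    and flux: "\<And>x. x \<in> {a<..<b} \<Longrightarrow> flux B T \<alpha> (v x) (v1 x) (v2 x) \<ge> 0"
    and x: "x \<in> {a..b}"
  shows "u x = u a"
proof -
  have v: "v y \<le> 0" if "y \<in> {a..b}" for y
  proof (rule nonpos_if_weighted_derivative_nondecreasing[OF cv dv weighted_derivative_has_derivative[OF B dv dv1]])
    show "0 < (1 + (v z)\<^sup>2) powr (- \<alpha> / 2)" for z
      using sum_power2_gt_zero_iff[of 1 "v z"] by simp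
    show "0 \<le> (1 + (v z)\<^sup>2) powr (\<alpha> / 2) / B *
        (flux B T \<alpha> (v z) (v1 z) (v2 z) + T * (v z / sqrt (1 + (v z)\<^sup>2)))"
      if "z \<in> {a<..<b}" "v z > 0" for z
      using flux[OF that(1)] that(2) B T by (intro mult_nonneg_nonneg add_nonneg_nonneg divide_nonneg_nonneg) auto
  qed (use ends that in auto)
  have anti: "u z \<le> u y" if "a \<le> y" "y \<le> z" "z \<le> b" for y z
  proof (rule DERIV_nonpos_imp_decreasing_open[OF that(2)])
    show "\<exists>d. (u has_real_derivative d) (at w) \<and> d \<le> 0" if "y < w" "w < z" for w
      using du[of w] v[of w] that \<open>a \<le> y\<close> \<open>z \<le> b\<close> by auto
    show "continuous_on {y..z} u"
      using cu that by (rule_tac continuous_on_subset) auto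
  qed
  show ?thesis
    using anti[of a x] anti[of x b] x ends by auto
qed

lemma constant_if_flux_nonpos:
  fixes u v v1 v2 :: "real \<Rightarrow> real"
  assumes B: "B > 0" and T: "T \<ge> 0"
    and cu: "continuous_on {a..b} u" and cv: "continuous_on {a..b} v"
    and du: "\<And>x. x \<in> {a<..<b} \<Longrightarrow> (u has_real_derivative v x) (at x)"
    and dv: "\<And>x. x \<in> {a<..<b} \<Longrightarrow> (v has_real_derivative v1 x) (at x)"
    and dv1: "\<And>x. x \<in> {a<..<b} \<Longrightarrow> (v1 has_real_derivative v2 x) (at x)"
    and ends: "v a = 0" "v b = 0" "u b \<le> u a"
    and flux: "\<And>x. x \<in> {a<..<b} \<Longrightarrow> flux B T \<alpha> (v x) (v1 x) (v2 x) \<le> 0"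
    and x: "x \<in> {a..b}"
  shows "u x = u a"
proof -
  have "- u x = - u a"
    using constant_if_flux_nonneg[of B T a b "\<lambda>x. - u x" "\<lambda>x. - v x" "\<lambda>x. - v1 x" "\<lambda>x. - v2 x" \<alpha> x]
      assms by (auto simp: flux_minus intro!: continuous_intros derivative_intros)
  then show ?thesis by simp
qed

lemma flux_eq_0_if_constant:
  fixes u v v1 v2 :: "real \<Rightarrow> real"
  assumes du: "\<And>x. x \<in> {a<..<b} \<Longrightarrow> (u has_real_derivative v x) (at x)"
    and dv: "\<And>x. x \<in> {a<..<b} \<Longrightarrow> (v has_real_derivative v1 x) (at x)"
    and dv1: "\<And>x. x \<in> {a<..<b} \<Longrightarrow> (v1 has_real_derivative v2 x) (at x)"
    and const: "\<And>x. x \<in> {a<..<b} \<Longrightarrow> u x = c"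
    and x: "x \<in> {a<..<b}"
  shows "flux B T \<alpha> (v x) (v1 x) (v2 x) = 0"
proof -
  have zero: "g' x = 0"
    if "\<And>x. x \<in> {a<..<b} \<Longrightarrow> (g has_real_derivative g' x) (at x)"
      "\<And>x. x \<in> {a<..<b} \<Longrightarrow> g x = k" "x \<in> {a<..<b}" for g g' :: "real \<Rightarrow> real" and k x
  proof -
    have "((\<lambda>_. k) has_real_derivative g' x) (at x)"
      by (rule has_field_derivative_transform_within_open[OF that(1)[OF that(3)] open_greaterThanLessThan that(3)])
        (use that(2) in auto)
    then show ?thesis
      using DERIV_unique[OF _ DERIV_const] by blast
  qed
  have v: "v y = 0" if "y \<in> {a<..<b}" for y by (rule zero[OF du const that])
  have v1: "v1 y = 0" if "y \<in> {a<..<b}" for y by (rule zero[OF dv v that])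
  have v2: "v2 y = 0" if "y \<in> {a<..<b}" for y by (rule zero[OF dv1 v1 that])
  show ?thesis using v v1 v2 x by simp
qed

section \<open>Derivatives within an interval\<close>

lemma deriv_within_open:
  assumes "open S" "x \<in> S"
  shows "deriv_within S g x = deriv g x"
proof -
  have "(g has_real_derivative d) (at x within S) \<longleftrightarrow> (g has_real_derivative d) (at x)" for d
    using assms by (simp only: at_within_open[of x S])
  then show ?thesis
    by (simp add: deriv_within_def deriv_def vector_derivative_def
        has_real_derivative_iff_has_vector_derivative)
qed

lemma deriv_within_has_derivative:
  assumes "g differentiable_on S" "x \<in> S"
  shows "(g has_vector_derivative deriv_within S g x) (at x within S)"
  using assms unfolding differentiable_on_def deriv_within_def
  by (metis vector_derivative_works)

lemma iterated_deriv_within_open: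
  assumes "open S" "x \<in> S"
  shows "(deriv_within S ^^ j) g x = (deriv ^^ j) g x"
  using assms(2)
proof (induction j arbitrary: x)
  case (Suc j)
  have "deriv ((deriv_within S ^^ j) g) x = deriv ((deriv ^^ j) g) x"
    using Suc.IH Suc.prems assms(1)
    by (intro deriv_cong_ev refl) (auto simp: eventually_nhds)
  then show ?case
    using deriv_within_open[OF assms(1) Suc.prems] by simp
qed simp

lemma C_class_open_has_derivative:
  assumes "open S" "C_class k S g" "j < k" "x \<in> S"
  shows "((deriv ^^ j) g has_real_derivative (deriv ^^ Suc j) g x) (at x)"
proof -
  have "(deriv_within S ^^ j) g differentiable_on S"
    using assms by (simp add: C_class_def)
  from deriv_within_has_derivative[OF this \<open>x \<in> S\<close>]
  have "((deriv_within S ^^ j) g has_real_derivative (deriv_within S ^^ Suc j) g x) (at x)"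
    using at_within_open[OF assms(4,1)]
    by (simp only: has_real_derivative_iff_has_vector_derivative funpow.simps o_apply)
  then have "((deriv_within S ^^ j) g has_real_derivative (deriv ^^ Suc j) g x) (at x)"
    by (simp only: iterated_deriv_within_open[OF assms(1,4)])
  then show ?thesis
    by (rule has_field_derivative_transform_within_open[OF _ assms(1,4)])
      (simp add: iterated_deriv_within_open assms(1))
qed

section \<open>The equation in divergence form\<close>

text \<open>
  Carrying out the inner derivative of \<open>(v' / (1+v\<^sup>2)\<^sup>\<alpha>)''\<close> produces \<open>-2 \<alpha> v v'\<^sup>2 / (1+v\<^sup>2)\<^sup>\<alpha>\<^sup>+\<^sup>1\<close>,
  and the second term of the operator cancels half of it.
\<close>

lemma flux_has_derivative:
  fixes u :: "real \<Rightarrow> real"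
  assumes S: "open S" "x \<in> S"
    and d0: "\<And>x. x \<in> S \<Longrightarrow> (u has_real_derivative deriv u x) (at x)"
    and d1: "\<And>x. x \<in> S \<Longrightarrow> (deriv u has_real_derivative u2 x) (at x)"
    and d2: "\<And>x. x \<in> S \<Longrightarrow> (u2 has_real_derivative u3 x) (at x)"
    and d3: "\<And>x. x \<in> S \<Longrightarrow> (u3 has_real_derivative u4 x) (at x)"
  shows "((\<lambda>x. flux B T \<alpha> (deriv u x) (u2 x) (u3 x)) has_real_derivative
    quasilinear_operator B T \<alpha> u x) (at x)"
proof -
  define v where "v = deriv u"
  define s where "s y = 1 + (v y)\<^sup>2" for y
  have s: "s y > 0" for y unfolding s_def by (simp add: add_pos_nonneg)
  have dv: "(v has_real_derivative u2 y) (at y)" if "y \<in> S" for y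
    using d1 that by (simp add: v_def)
  have ds: "(s has_real_derivative 2 * v y * u2 y) (at y)" if "y \<in> S" for y
    unfolding s_def by (auto intro!: derivative_eq_intros dv that)
  have u2: "deriv (deriv u) y = u2 y" if "y \<in> S" for y
    using d1 that by (rule_tac DERIV_imp_deriv)
  have powr: "((\<lambda>y. s y powr r) has_real_derivative r * s y powr (r - 1) * (2 * v y * u2 y)) (at y)"
    if "y \<in> S" for r y
    using DERIV_powr[OF ds[OF that] s DERIV_const[of r]] s[of y]
    by (simp add: powr_diff field_simps)
  define G where "G y = u2 y / s y powr \<alpha>" for y
  define G1 where "G1 y = u3 y / s y powr \<alpha> - 2 * \<alpha> * (v y * (u2 y)\<^sup>2 / s y powr (\<alpha> + 1))" for y
  define H where "H y = v y * (u2 y)\<^sup>2 / s y powr (\<alpha> + 1)" for y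
  define K where "K y = v y / sqrt (s y)" for y
  have G: "(G has_real_derivative G1 y) (at y)" if y: "y \<in> S" for y
  proof -
    have "(G has_real_derivative
        (u3 y * s y powr \<alpha> - u2 y * (\<alpha> * s y powr (\<alpha> - 1) * (2 * v y * u2 y)))
          / (s y powr \<alpha> * s y powr \<alpha>)) (at y)"
      unfolding G_def using s[of y] by (intro DERIV_divide d2 powr y) auto
    moreover have "(u3 y * s y powr \<alpha> - u2 y * (\<alpha> * s y powr (\<alpha> - 1) * (2 * v y * u2 y)))
          / (s y powr \<alpha> * s y powr \<alpha>) = G1 y"
      using s[of y] by (simp add: G1_def powr_diff powr_add field_simps power2_eq_square)
    ultimately show ?thesis by simp
  qed
  have spow: "(\<lambda>y. s y powr r) differentiable at x" for r
    using powr[OF S(2)] real_differentiable_def by blast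
  have diffs: "v differentiable at x" "u2 differentiable at x" "u3 differentiable at x" "s differentiable at x"
    using dv d2 d3 ds S(2) real_differentiable_def by blast+
  have "G1 differentiable at x"
    unfolding G1_def using s[of x]
    by (intro derivative_intros differentiable_diff differentiable_mult differentiable_divide
        differentiable_power spow diffs differentiable_const) auto
  then have dG1: "(G1 has_real_derivative deriv G1 x) (at x)"
    by (simp add: DERIV_deriv_iff_real_differentiable)
  have "H differentiable at x"
    unfolding H_def using s[of x]
    by (intro differentiable_mult differentiable_divide
        differentiable_power spow diffs differentiable_const) auto
  then have dH: "(H has_real_derivative deriv H x) (at x)"
    by (simp add: DERIV_deriv_iff_real_differentiable)
  have "sqrt differentiable at (s x)"
    using DERIV_real_sqrt[OF s[of x]] real_differentiable_def by blast
  with diffs(4) have "(\<lambda>y. sqrt (s y)) differentiable at x"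
    using differentiable_chain_at[of s x sqrt] by (simp add: o_def)
  then have "K differentiable at x"
    unfolding K_def using s[of x] by (intro differentiable_divide diffs) auto
  then have dK: "(K has_real_derivative deriv K x) (at x)"
    by (simp add: DERIV_deriv_iff_real_differentiable)
  have ev: "eventually (\<lambda>y. y \<in> S) (nhds x)"
    using S by (rule eventually_nhds_in_open)
  have "deriv (\<lambda>y. deriv (deriv u) y / (1 + (deriv u y)\<^sup>2) powr \<alpha>) y = G1 y" if "y \<in> S" for y
  proof -
    have "deriv (\<lambda>y. deriv (deriv u) y / (1 + (deriv u y)\<^sup>2) powr \<alpha>) y = deriv G y"
      using eventually_nhds_in_open[OF S(1) that]
      by (intro deriv_cong_ev refl) (auto elim!: eventually_mono simp: G_def u2 s_def v_def)
    with G[OF that] show ?thesis by (simp add: DERIV_imp_deriv)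
  qed
  then have "deriv (deriv (\<lambda>y. deriv (deriv u) y / (1 + (deriv u y)\<^sup>2) powr \<alpha>)) x = deriv G1 x"
    using ev by (intro deriv_cong_ev refl) (auto elim!: eventually_mono)
  moreover have "deriv (\<lambda>y. deriv u y * (deriv (deriv u) y)\<^sup>2 / (1 + (deriv u y)\<^sup>2) powr (\<alpha> + 1)) x = deriv H x"
    using ev by (intro deriv_cong_ev refl) (auto elim!: eventually_mono simp: H_def u2 s_def v_def)
  moreover have "(\<lambda>y. deriv u y / sqrt (1 + (deriv u y)\<^sup>2)) = K"
    by (simp add: fun_eq_iff K_def s_def v_def)
  ultimately have op: "quasilinear_operator B T \<alpha> u x = B * deriv G1 x + \<alpha> * B * deriv H x - T * deriv K x"
    unfolding quasilinear_operator_def by simp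
  have "(\<lambda>x. flux B T \<alpha> (deriv u x) (u2 x) (u3 x)) = (\<lambda>x. B * G1 x + \<alpha> * B * H x - T * K x)"
    by (simp add: fun_eq_iff flux_def G1_def H_def K_def v_def s_def algebra_simps)
  then show ?thesis
    unfolding op by (simp only:) (intro DERIV_diff DERIV_add DERIV_cmult dG1 dH dK)
qed

section \<open>Negativity of the solution\<close>

theorem mainTheorem6:
  fixes B T \<alpha> :: real and f u :: "real \<Rightarrow> real"
  assumes "B > 0" and "T \<ge> 0" and "\<alpha> > 0"
    and "classical_solution B T \<alpha> f u"
    and "\<forall>x\<in>{-1<..<1}. f x \<le> 0"
    and "\<exists>x\<in>{-1<..<1}. f x \<noteq> 0"
  shows "\<forall>x\<in>{-1<..<1}. u x < 0"
proof (rule ccontr)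
  assume "\<not> (\<forall>x\<in>{-1<..<1}. u x < 0)"
  then obtain x0 where x0: "x0 \<in> {-1<..<1}" "u x0 \<ge> 0" by force
  define I where "I = {-1<..<1::real}"
  have C4: "C_class 4 I u" and C2: "C_class 2 {-1..1} u"
    and eq: "\<And>x. x \<in> I \<Longrightarrow> quasilinear_operator B T \<alpha> u x = f x"
    and u_ends: "u (-1) = 0" "u 1 = 0"
    and v_ends: "deriv_within {-1..1} u (-1) = 0" "deriv_within {-1..1} u 1 = 0"
    using assms(4) by (auto simp: classical_solution_def I_def)
  have I: "open I" by (simp add: I_def)

  \<comment> \<open>\<open>v\<close> extends \<open>deriv u\<close> continuously to the end points, where \<open>deriv u\<close> need not be meaningful\<close>
  define v where "v = deriv_within {-1..1} u"
  define u2 where "u2 = (deriv ^^ 2) u"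
  define u3 where "u3 = (deriv ^^ 3) u"
  have cont: "continuous_on {-1..1} ((deriv_within {-1..1} ^^ j) u)" if "j \<le> 2" for j
    using C2 that by (simp add: C_class_def)
  have cu: "continuous_on {-1..1} u" and cv: "continuous_on {-1..1} v"
    using cont[of 0] cont[of 1] by (simp_all add: v_def)
  have d0: "(u has_real_derivative deriv u x) (at x)" if "x \<in> I" for x
    using C_class_open_has_derivative[OF I C4, of 0 x] that by simp
  have d1: "(deriv u has_real_derivative u2 x) (at x)" if "x \<in> I" for x
    using C_class_open_has_derivative[OF I C4, of 1 x] that by (simp add: u2_def numeral_2_eq_2)
  have d2: "(u2 has_real_derivative u3 x) (at x)" if "x \<in> I" for x
    using C_class_open_has_derivative[OF I C4, of 2 x] that by (simp add: u2_def u3_def numeral_eq_Suc)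
  have d3: "(u3 has_real_derivative (deriv ^^ 4) u x) (at x)" if "x \<in> I" for x
    using C_class_open_has_derivative[OF I C4, of 3 x] that by (simp add: u3_def numeral_eq_Suc)
  have v: "v x = deriv u x" if "x \<in> I" for x
  proof -
    have "at x within {-1..1} = at x"
      using that by (intro at_within_interior) (auto simp: I_def)
    then have "(u has_vector_derivative v x) (at x)"
      using deriv_within_has_derivative[of u "{-1..1}" x] C2 that
      by (force simp: C_class_def v_def I_def)
    then show ?thesis
      using d0[OF that] by (metis DERIV_unique has_real_derivative_iff_has_vector_derivative)
  qed
  have du: "(u has_real_derivative v x) (at x)" if "x \<in> I" for x
    using d0 v that by simp
  have dv: "(v has_real_derivative u2 x) (at x)" if "x \<in> I" for x
    by (rule has_field_derivative_transform_within_open[OF d1[OF that] I that]) (simp add: v)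

  define F where "F x = flux B T \<alpha> (v x) (u2 x) (u3 x)" for x
  have dF: "(F has_real_derivative f x) (at x)" if "x \<in> I" for x
    using flux_has_derivative[OF I that d0 d1 d2 d3, of B T \<alpha>] eq[OF that]
    by (auto simp: F_def v intro: has_field_derivative_transform_within_open[OF _ I that])
  have anti: "F y \<le> F x" if "x \<in> I" "y \<in> I" "x \<le> y" for x y
  proof (rule DERIV_nonpos_imp_nonincreasing[OF \<open>x \<le> y\<close>])
    show "\<exists>d. (F has_real_derivative d) (at w) \<and> d \<le> 0" if "x \<le> w" "w \<le> y" for w
      using dF[of w] assms(5) that \<open>x \<in> I\<close> \<open>y \<in> I\<close> by (auto simp: I_def)
  qed

  obtain m where m: "m \<in> I" "u m \<ge> 0" and max: "\<And>y. y \<in> {-1..1} \<Longrightarrow> u y \<le> u m"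
  proof -
    obtain n where n: "n \<in> {-1..1}" "\<And>y. y \<in> {-1..1} \<Longrightarrow> u y \<le> u n"
      using continuous_attains_sup[OF compact_Icc _ cu] by force
    show ?thesis
    proof (cases "n \<in> I")
      case True
      moreover have "u x0 \<le> u n" using n(2)[of x0] x0(1) by simp
      ultimately show ?thesis using n(2) x0(2) by (intro that[of n]) auto
    next
      \<comment> \<open>a maximum on the boundary has the value \<open>0\<close>, which \<open>u\<close> then attains at \<open>x0\<close> as well\<close>
      case False
      then have "n = -1 \<or> n = 1" using n(1) by (auto simp: I_def)
      then have "u n = 0" using u_ends by auto
      moreover have "u x0 \<le> u n" using n(2)[of x0] x0(1) by simp
      ultimately show ?thesis using n(2) x0 by (intro that[of x0]) (auto simp: I_def)
    qed
  qed
  have mI: "-1 < m" "m < 1" using m by (auto simp: I_def)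
  have vm: "v m = 0"
  proof (rule DERIV_local_max[OF du[OF m(1)]])
    show "0 < min (m + 1) (1 - m)" using m by (simp add: I_def)
    show "\<forall>y. \<bar>m - y\<bar> < min (m + 1) (1 - m) \<longrightarrow> u y \<le> u m"
      using mI by (intro allI impI max) auto
  qed

  have left: "u x = 0" if "\<And>y. y \<in> {-1<..<m} \<Longrightarrow> F y \<ge> 0" "x \<in> {-1..m}" for x
  proof -
    have "u x = u (-1)"
      by (rule constant_if_flux_nonneg[where v = v and ?v1.0 = u2 and ?v2.0 = u3 and a = "-1" and b = m, OF assms(1,2)])
        (use mI m that u_ends v_ends vm in \<open>auto simp: F_def I_def v_def[symmetric]
          intro!: du dv d2 continuous_on_subset[OF cu] continuous_on_subset[OF cv]\<close>)
    then show ?thesis using u_ends by simp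
  qed
  have right: "u x = 0" if "\<And>y. y \<in> {m<..<1} \<Longrightarrow> F y \<le> 0" "x \<in> {m..1}" for x
  proof -
    have *: "u x = u m" if "x \<in> {m..1}" for x
      by (rule constant_if_flux_nonpos[where v = v and ?v1.0 = u2 and ?v2.0 = u3 and a = m and b = 1, OF assms(1,2)])
        (use mI m that \<open>\<And>y. y \<in> {m<..<1} \<Longrightarrow> F y \<le> 0\<close> u_ends v_ends vm in \<open>auto simp: F_def I_def v_def[symmetric]
          intro!: du dv d2 continuous_on_subset[OF cu] continuous_on_subset[OF cv]\<close>)
    show ?thesis using *[OF that(2)] *[of 1] mI u_ends by simp
  qed
  have F0: "F x = 0" if "-1 \<le> a" "b \<le> 1" "\<And>x. x \<in> {a<..<b} \<Longrightarrow> u x = 0" "x \<in> {a<..<b}" for a b x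
    unfolding F_def
    by (rule flux_eq_0_if_constant[where u = u and a = a and b = b and c = 0])
      (use that in \<open>auto intro!: du dv d2 simp: I_def\<close>)

  have zero: "u x = 0" if "x \<in> {-1..1}" for x
  proof (cases "F m \<ge> 0")
    case True
    then have L: "u y = 0" if "y \<in> {-1..m}" for y
      using that anti[of _ m] m mI by (intro left) (force simp: I_def)+
    define z where "z = (m - 1) / 2"
    have z: "-1 < z" "z < m" using mI by (auto simp: z_def)
    have "F z = 0"
      using L mI z by (intro F0[of "-1" m]) auto
    then have "F y \<le> 0" if "y \<in> {m<..<1}" for y
      using that anti[of z y] z mI by (auto simp: I_def)
    then show ?thesis
      using L right \<open>x \<in> {-1..1}\<close> by (cases "x \<le> m") auto
  next
    case False
    then have R: "u y = 0" if "y \<in> {m..1}" for y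
      using that anti[of m] m mI by (intro right) (force simp: I_def)+
    define z where "z = (m + 1) / 2"
    have z: "m < z" "z < 1" using mI by (auto simp: z_def)
    have "F z = 0"
      using R mI z by (intro F0[of m 1]) auto
    then have "F y \<ge> 0" if "y \<in> {-1<..<m}" for y
      using that anti[of y z] z mI by (auto simp: I_def)
    then show ?thesis
      using R left \<open>x \<in> {-1..1}\<close> by (cases "x \<le> m") auto
  qed

  obtain y where y: "y \<in> I" "f y \<noteq> 0"
    using assms(6) by (auto simp: I_def)
  have "F x = 0" if "x \<in> I" for x
    using that zero by (intro F0[of "-1" 1]) (auto simp: I_def)
  then have "((\<lambda>_. 0) has_real_derivative f y) (at y)"
    by (intro has_field_derivative_transform_within_open[OF dF[OF y(1)] I y(1)])
  then show False
    using y(2) DERIV_unique[OF _ DERIV_const] by blast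
qed

end
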